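(* Let $n \ge 2$ be an integer and let $A = (a_{ij})$ be an $n \times n$ real matrix with $a_{ij} > 0$ for all $i,j$. Then $$\kappa(A) \le \tau(A),$$ where $\kappa(A)$ is the spectral ratio of $A$ and $\tau(A)$ is the Birkhoff contraction coefficient of $A$.
   Context: Let $n \ge 2$ and let $A = (a_{ij})$ be an $n\times n$ positive matrix, i.e. all entries $a_{ij}$ are strictly positive real numbers. Spectral ratio: by Perron's theorem, the eigenvalue of $A$ of largest modulus, denoted $\rho(A)$, is unique, real and positive. The spectral ratio of $A$ is $$\kappa(A) = \frac{\max\{|\lambda| : \lambda \in \mathbb{C} \text{ is an eigenvalue of } A,\ \lambda \ne \rho(A)\}}{\rho(A)}.$$ Hilbert metric: let $W^\circ = \{w = (w_1,\dots,w_n) \in \mathbb{R}^n : \sum_{i=1}^n w_i = 1,\ w_i > 0 \text{ for all } i\}$ be the interior of the standard simplex. For $v, w \in W^\circ$, set $$d_H(v,w) = \max_{i,j} \log\left(\frac{w_i/w_j}{v_i/v_j}\right).$$ Induced map: for a vector $w \in \mathbb{R}^n$ with all entries positive, let $\mathcal{N}(w) = (w_1,\dots,w_n)/(w_1+\dots+w_n) \in W^\circ$, and let $f_A : W^\circ \to W^\circ$ be given by $f_A(w) = \mathcal{N}(Aw)$. Birkhoff contraction coefficient: $$\tau(A) = \sup_{v, w \in W^\circ,\ v \ne w} \frac{d_H(f_A(v), f_A(w))}{d_H(v,w)}.$$ It is well known that $\tau(A)$ is given explicitly by $$\tau(A) = \frac{1-\sqrt{\phi(A)}}{1+\sqrt{\phi(A)}},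 \qquad \phi(A) = \min_{i,j,k,l} \frac{a_{ik}a_{jl}}{a_{jk}a_{il}}.$$ *)

theory Defs
  imports "Jordan_Normal_Form.Spectral_Radius"
begin

text \<open>
  Eigenvalues of a real matrix are always taken over the complex numbers, i.e. they are the
  eigenvalues of its entrywise image in the complex matrices.
\<close>

abbreviation complex_eigenvalue :: "real mat \<Rightarrow> complex \<Rightarrow> bool" where
  "complex_eigenvalue A \<equiv> eigenvalue (map_mat complex_of_real A)"

text \<open>
  The eigenvalue of largest modulus. By Perron's theorem it is unique, real and positive
  for a positive matrix, so the description is proper there and \<^term>\<open>Re\<close> only changes the type.
\<close>

definition perron_root :: "real mat \<Rightarrow> real" where
  "perron_root A = Re (THE l. complex_eigenvalue A l \<and>
     (\<forall>m. complex_eigenvalue A m \<longrightarrow> cmod m \<le> cmod l))"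

text \<open>
  The set of remaining eigenvalues is finite, and for a positive matrix of size at least 2 it is
  nonempty, because the Perron root is a simple root of the characteristic polynomial.
\<close>

definition spectral_ratio :: "real mat \<Rightarrow> real" where
  "spectral_ratio A =
     Max {cmod l | l. complex_eigenvalue A l \<and> l \<noteq> complex_of_real (perron_root A)}
       / perron_root A"

definition simplex_interior :: "nat \<Rightarrow> real vec set" where
  "simplex_interior n =
     {w \<in> carrier_vec n. (\<Sum>i<n. w $ i) = 1 \<and> (\<forall>i<n. 0 < w $ i)}"

definition hilbert_dist :: "real vec \<Rightarrow> real vec \<Rightarrow> real" where
  "hilbert_dist v w =
     Max {ln ((w $ i / w $ j) / (v $ i / v $ j)) | i j. i < dim_vec v \<and> j < dim_vec v}"

definition normalize_vec :: "real vec \<Rightarrow> real vec" where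
  "normalize_vec w = (1 / (\<Sum>i<dim_vec w. w $ i)) \<cdot>\<^sub>v w"

definition induced_map :: "real mat \<Rightarrow> real vec \<Rightarrow> real vec" where
  "induced_map A w = normalize_vec (A *\<^sub>v w)"

text \<open>
  The supremum is taken in the reals; for a positive matrix of size at least 2 it ranges over a
  nonempty set that is bounded above by 1, as positive matrices do not increase the Hilbert metric.
\<close>

definition birkhoff_coeff :: "real mat \<Rightarrow> real" where
  "birkhoff_coeff A =
     Sup {hilbert_dist (induced_map A v) (induced_map A w) / hilbert_dist v w | v w.
       v \<in> simplex_interior (dim_col A) \<and> w \<in> simplex_interior (dim_col A) \<and> v \<noteq> w}"

end

theory Submission
  imports Defs
begin

text \<open>
  Let \<open>u\<close> be the Perron eigenvector. Near \<open>u\<close> the Hilbert metric is, to first order, the oscillation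
  seminorm \<open>osc z = max\<^sub>i z\<^sub>i / u\<^sub>i - min\<^sub>i z\<^sub>i / u\<^sub>i\<close>, so differentiating
  the contraction property at the fixed point \<open>u\<close> of the induced map gives
  \<open>osc (A z) \<le> \<rho>(A) \<tau>(A) osc z\<close> for real \<open>z\<close>. A complex eigenvector \<open>x\<close> for an eigenvalue
  \<open>l \<noteq> \<rho>(A)\<close> is not a multiple of \<open>u\<close>; choosing a pair of indices that maximizes
  \<open>\<bar>x\<^sub>i / u\<^sub>i - x\<^sub>j / u\<^sub>j\<bar>\<close> and a suitable phase, the inequality for the real part of the
  rotated eigenvector yields \<open>\<bar>l\<bar> \<le> \<rho>(A) \<tau>(A)\<close>.

  For Perron's theorem, the moduli of the entries of an eigenvector of maximal modulus form a vector
  \<open>y\<close> with \<open>\<rho> y \<le> A y\<close>. If this were not an equality, \<open>s y' \<le> A y'\<close> would hold with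
  \<open>y' = A y\<close> and some \<open>s > \<rho>\<close>, contradicting the growth rate of the powers of \<open>A\<close>. An eigenvalue
  other than \<open>\<rho>\<close> exists because each diagonal entry is below \<open>\<rho>\<close>, hence so is the mean of
  the eigenvalues.
\<close>

lemma mult_mat_vec_index:
  assumes "A \<in> carrier_mat n m" "v \<in> carrier_vec m" "i < n"
  shows "(A *\<^sub>v v) $ i = (\<Sum>j<m. A $$ (i,j) * v $ j)"
  using assms by (auto simp: scalar_prod_def lessThan_atLeast0 intro!: sum.cong)

section \<open>The Hilbert metric on positive vectors\<close>

lemma hilbert_dist_image:
  "hilbert_dist v w = Max ((\<lambda>(i, j). ln ((w $ i / w $ j) / (v $ i / v $ j)))
     ` ({..<dim_vec v} \<times> {..<dim_vec v}))"
  unfolding hilbert_dist_def by (rule arg_cong[where f = Max]) force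

lemma hilbert_dist_ge:
  assumes "i < dim_vec v" "j < dim_vec v"
  shows "ln ((w $ i / w $ j) / (v $ i / v $ j)) \<le> hilbert_dist v w"
  unfolding hilbert_dist_image by (rule Max_ge) (use assms in force)+

lemma hilbert_dist_le:
  assumes "0 < dim_vec v"
    and "\<And>i j. i < dim_vec v \<Longrightarrow> j < dim_vec v \<Longrightarrow> ln ((w $ i / w $ j) / (v $ i / v $ j)) \<le> c"
  shows "hilbert_dist v w \<le> c"
  unfolding hilbert_dist_image by (rule Max.boundedI) (use assms in force)+

text \<open>Scalars cancel in the cross ratios, so the metric sees only rays. This lets every later
  argument discard the normalization in \<open>induced_map\<close>.\<close>

lemma hilbert_dist_smult:
  assumes "a \<noteq> 0" "b \<noteq> 0" "dim_vec v = dim_vec w"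
  shows "hilbert_dist (a \<cdot>\<^sub>v v) (b \<cdot>\<^sub>v w) = hilbert_dist v w"
  unfolding hilbert_dist_image
  by (rule arg_cong[where f = Max], rule image_cong) (use assms in auto)

text \<open>The open cone over \<open>simplex_interior\<close>. Unlike the simplex it is mapped into
  itself by a positive matrix and contains small perturbations of its points without
  renormalizing.\<close>

definition pos_vecs :: "nat \<Rightarrow> real vec set" where
  "pos_vecs n = {v \<in> carrier_vec n. \<forall>i<n. 0 < v $ i}"

lemma pos_vecsD:
  assumes "v \<in> pos_vecs n"
  shows "v \<in> carrier_vec n" "dim_vec v = n" "\<And>i. i < n \<Longrightarrow> 0 < v $ i"
  using assms by (auto simp: pos_vecs_def)

lemma hilbert_dist_nonneg:
  assumes "v \<in> pos_vecs n" "w \<in> pos_vecs n" "0 < n"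
  shows "0 \<le> hilbert_dist v w"
  using hilbert_dist_ge[of 0 v 0 w] pos_vecsD(2)[OF assms(1)] pos_vecsD(3)[OF assms(1,3)]
    pos_vecsD(3)[OF assms(2,3)] assms(3)
  by simp

lemma hilbert_dist_self:
  assumes "v \<in> pos_vecs n" "0 < n"
  shows "hilbert_dist v v = 0"
proof (rule antisym[OF _ hilbert_dist_nonneg[OF assms(1,1,2)]])
  show "hilbert_dist v v \<le> 0"
  proof (rule hilbert_dist_le)
    fix i j assume "i < dim_vec v" "j < dim_vec v"
    then have "0 < v $ i" "0 < v $ j" using pos_vecsD[OF assms(1)] by auto
    then show "ln ((v $ i / v $ j) / (v $ i / v $ j)) \<le> 0" by simp
  qed (use pos_vecsD[OF assms(1)] assms(2) in simp)
qed

lemma simplex_interior_pos_vecs: "simplex_interior n \<subseteq> pos_vecs n"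
  by (auto simp: simplex_interior_def pos_vecs_def)

lemma normalize_vec_eq_smult:
  assumes "v \<in> pos_vecs n" "0 < n"
  obtains a where "0 < a" "normalize_vec v = a \<cdot>\<^sub>v v"
proof
  have "0 < (\<Sum>i<dim_vec v. v $ i)"
    by (rule sum_pos) (use assms pos_vecsD[OF assms(1)] in auto)
  then show "0 < 1 / (\<Sum>i<dim_vec v. v $ i)" by simp
qed (simp add: normalize_vec_def)

lemma normalize_vec_simplex:
  assumes "v \<in> pos_vecs n" "0 < n"
  shows "normalize_vec v \<in> simplex_interior n"
proof -
  have "0 < (\<Sum>i<n. v $ i)"
    by (rule sum_pos) (use assms pos_vecsD[OF assms(1)] in auto)
  then show ?thesis
    using pos_vecsD[OF assms(1)]
    by (auto simp: simplex_interior_def normalize_vec_def sum_divide_distrib[symmetric])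
qed

section \<open>Powers of nonnegative matrices and the spectral radius\<close>

lemma pow_mat_nonneg:
  fixes B :: "real mat"
  assumes B: "B \<in> carrier_mat n n" and nn: "\<And>i j. i < n \<Longrightarrow> j < n \<Longrightarrow> 0 \<le> B $$ (i, j)"
    and "i < n" "j < n"
  shows "0 \<le> (B ^\<^sub>m k) $$ (i, j)"
  using \<open>i < n\<close> \<open>j < n\<close>
proof (induction k arbitrary: i j)
  case (Suc k)
  have "(B ^\<^sub>m k * B) $$ (i, j) = (\<Sum>l<n. (B ^\<^sub>m k) $$ (i, l) * B $$ (l, j))"
    using B Suc.prems pow_carrier_mat[OF B, of k]
    by (auto simp: scalar_prod_def lessThan_atLeast0 intro!: sum.cong)
  also have "0 \<le> \<dots>" using Suc nn by (intro sum_nonneg mult_nonneg_nonneg) auto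
  finally show ?case by simp
qed (use B in auto)

text \<open>Induction on \<open>k\<close>: the powers of \<open>B\<close> are entrywise nonnegative,
  so applying them preserves the inequality between \<open>q\<close> times \<open>y\<close> and
  \<open>B *\<^sub>v y\<close>.\<close>

lemma pow_mat_subinvariant:
  fixes B :: "real mat"
  assumes B: "B \<in> carrier_mat n n" and nn: "\<And>i j. i < n \<Longrightarrow> j < n \<Longrightarrow> 0 \<le> B $$ (i, j)"
    and y: "y \<in> carrier_vec n" and sub: "\<And>i. i < n \<Longrightarrow> q * y $ i \<le> (B *\<^sub>v y) $ i"
    and q: "0 \<le> q" and "i < n"
  shows "q ^ k * y $ i \<le> (B ^\<^sub>m k *\<^sub>v y) $ i"
  using \<open>i < n\<close>
proof (induction k)
  case (Suc k)
  note P = pow_carrier_mat[OF B, of k]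
  have By: "B *\<^sub>v y \<in> carrier_vec n" using B y by simp
  have "q ^ Suc k * y $ i \<le> q * (B ^\<^sub>m k *\<^sub>v y) $ i"
    using mult_left_mono[OF Suc.IH[OF Suc.prems] q] by (simp add: algebra_simps)
  also have "\<dots> = (\<Sum>j<n. (B ^\<^sub>m k) $$ (i, j) * (q * y $ j))"
    unfolding mult_mat_vec_index[OF P y Suc.prems] sum_distrib_left by (simp add: algebra_simps)
  also have "\<dots> \<le> (\<Sum>j<n. (B ^\<^sub>m k) $$ (i, j) * (B *\<^sub>v y) $ j)"
    by (rule sum_mono, rule mult_left_mono)
      (use sub pow_mat_nonneg[OF B nn Suc.prems] in auto)
  also have "\<dots> = (B ^\<^sub>m k *\<^sub>v (B *\<^sub>v y)) $ i"
    using mult_mat_vec_index[OF P By Suc.prems] by simp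
  also have "\<dots> = (B ^\<^sub>m Suc k *\<^sub>v y) $ i"
    using assoc_mult_mat_vec[OF P B y] by simp
  finally show ?case .
qed (use B y in auto)

text \<open>A Collatz-Wielandt lower bound. If \<open>s\<close> exceeded the spectral radius, then
  for some \<open>t\<close> strictly between them the powers of \<open>B\<close> scaled by
  \<open>1 / t\<close> would stay bounded, yet entry \<open>m\<close> of their action on
  \<open>y\<close> would grow at least like \<open>(s / t) ^ k\<close>.\<close>

lemma spectral_radius_ge_subinvariant:
  fixes B :: "real mat"
  assumes B: "B \<in> carrier_mat n n" and nn: "\<And>i j. i < n \<Longrightarrow> j < n \<Longrightarrow> 0 \<le> B $$ (i, j)"
    and y: "y \<in> carrier_vec n" and sub: "\<And>i. i < n \<Longrightarrow> s * y $ i \<le> (B *\<^sub>v y) $ i"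
    and m: "m < n" "0 < y $ m"
  shows "s \<le> spectral_radius (map_mat complex_of_real B)"
proof (rule ccontr)
  let ?C = "map_mat complex_of_real B"
  assume "\<not> ?thesis"
  then obtain t where t: "spectral_radius ?C < t" "t < s" using dense by (meson not_le)
  have C: "?C \<in> carrier_mat n n" using B by simp
  have n0: "0 < n" using m by simp
  have "0 \<le> spectral_radius ?C" using spectral_radius_mem_max(1)[OF C n0] by auto
  with t have t0: "0 < t" and s0: "0 < s" by auto
  define D where "D = (1 / t) \<cdot>\<^sub>m B"
  have D: "D \<in> carrier_mat n n" and nnD: "\<And>i j. i < n \<Longrightarrow> j < n \<Longrightarrow> 0 \<le> D $$ (i, j)"
    using B nn t0 by (auto simp: D_def)
  let ?D = "map_mat complex_of_real D"
  have CD: "?D \<in> carrier_mat n n" using D by simp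
  have "spectral_radius ?D < 1"
  proof -
    obtain l where l: "eigenvalue ?D l" "spectral_radius ?D = cmod l"
      using spectral_radius_mem_max(1)[OF CD n0] by (auto simp: spectrum_def)
    then obtain x where x: "eigenvector ?D x l" by (auto simp: eigenvalue_def)
    then have xc: "x \<in> carrier_vec n" using D by (auto simp: eigenvector_def)
    \<comment> \<open>Undoing the scaling turns an eigenvalue \<open>l\<close> of \<open>?D\<close>
      into the eigenvalue \<open>t * l\<close> of \<open>?C\<close>.\<close>
    have CD': "?C = complex_of_real t \<cdot>\<^sub>m ?D" using B t0 by (intro eq_matI) (auto simp: D_def)
    have "?C *\<^sub>v x = complex_of_real t \<cdot>\<^sub>v (?D *\<^sub>v x)"
      unfolding CD' using CD xc by (intro eq_vecI) auto
    also have "\<dots> = (of_real t * l) \<cdot>\<^sub>v x" using x by (simp add: eigenvector_def smult_smult_assoc)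
    finally have "eigenvalue ?C (of_real t * l)"
      using x B D by (auto simp: eigenvalue_def eigenvector_def intro!: exI[of _ x])
    then have "cmod (of_real t * l) \<le> spectral_radius ?C"
      by (intro spectral_radius_mem_max(2)[OF C n0]) (auto simp: spectrum_def)
    then have "t * cmod l \<le> spectral_radius ?C" using t0 by (simp add: norm_mult)
    then have "t * cmod l < t * 1" using t(1) by linarith
    then show ?thesis unfolding l(2) by (rule mult_less_cancel_left_pos[OF t0, THEN iffD1])
  qed
  \<comment> \<open>Spectral radius below 1 bounds all powers uniformly, by way of the Jordan normal
    form.\<close>
  then obtain c where c: "\<And>k. norm_bound (?D ^\<^sub>m k) c"
    using spectral_radius_jnf_norm_bound_less_1_upper_triangular[OF CD] by blast
  have bound: "\<bar>(D ^\<^sub>m k) $$ (i, j)\<bar> \<le> c" if "i < n" "j < n" for i j k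
  proof -
    have "?D ^\<^sub>m k = map_mat complex_of_real (D ^\<^sub>m k)"
      by (rule of_real_hom.mat_hom_pow[OF D, symmetric])
    then show ?thesis using c[of k] that D pow_carrier_mat[OF D, of k] by (auto simp: norm_bound_def)
  qed
  have le: "(s / t) ^ k * y $ m \<le> (\<Sum>j<n. c * \<bar>y $ j\<bar>)" for k
  proof -
    have "(s / t) ^ k * y $ m \<le> (D ^\<^sub>m k *\<^sub>v y) $ m"
    proof (rule pow_mat_subinvariant[OF D nnD y _ _ m(1)])
      fix i assume i: "i < n"
      have "(D *\<^sub>v y) $ i = (B *\<^sub>v y) $ i / t"
        unfolding mult_mat_vec_index[OF D y i] mult_mat_vec_index[OF B y i] sum_divide_distrib
        by (rule sum.cong) (use B i in \<open>auto simp: D_def\<close>)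
      then show "s / t * y $ i \<le> (D *\<^sub>v y) $ i"
        using sub[OF i] t0 by (simp add: divide_right_mono)
    qed (use s0 t0 in auto)
    also have "\<dots> = (\<Sum>j<n. (D ^\<^sub>m k) $$ (m, j) * y $ j)"
      by (rule mult_mat_vec_index[OF pow_carrier_mat[OF D] y m(1)])
    \<comment> \<open>Entries of \<open>y\<close> other than \<open>m\<close> may be negative, hence
      the absolute values.\<close>
    also have "\<dots> \<le> (\<Sum>j<n. c * \<bar>y $ j\<bar>)"
    proof (rule sum_mono)
      fix j assume "j \<in> {..<n}"
      then have "\<bar>(D ^\<^sub>m k) $$ (m, j)\<bar> * \<bar>y $ j\<bar> \<le> c * \<bar>y $ j\<bar>"
        using bound m(1) by (intro mult_right_mono) auto
      then show "(D ^\<^sub>m k) $$ (m, j) * y $ j \<le> c * \<bar>y $ j\<bar>"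
        using abs_le_D1 abs_mult by metis
    qed
    finally show ?thesis .
  qed
  have "1 < s / t" using t t0 by simp
  from real_arch_pow[OF this] obtain k where "(\<Sum>j<n. c * \<bar>y $ j\<bar>) / y $ m < (s / t) ^ k" by blast
  then show False using le[of k] m(2) by (simp add: field_simps)
qed

section \<open>Complex phases and traces\<close>

lemma cnj_sgn_mult: "cnj (sgn S) * S = of_real (cmod S)"
  by (cases "S = 0") (simp_all add: sgn_eq field_simps complex_norm_square[symmetric] power2_eq_square)

lemma trace_mult_commute:
  fixes P Q :: "'a :: comm_semiring_0 mat"
  assumes "P \<in> carrier_mat n m" "Q \<in> carrier_mat m n"
  shows "(\<Sum>i<n. (P * Q) $$ (i, i)) = (\<Sum>j<m. (Q * P) $$ (j, j))"
proof -
  have "(\<Sum>i<n. (P * Q) $$ (i, i)) = (\<Sum>i<n. \<Sum>j<m. P $$ (i, j) * Q $$ (j, i))"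
    using assms by (intro sum.cong) (auto simp: scalar_prod_def lessThan_atLeast0)
  also have "\<dots> = (\<Sum>j<m. \<Sum>i<n. Q $$ (j, i) * P $$ (i, j))"
    by (subst sum.swap) (simp add: mult.commute)
  also have "\<dots> = (\<Sum>j<m. (Q * P) $$ (j, j))"
    using assms by (intro sum.cong) (auto simp: scalar_prod_def lessThan_atLeast0)
  finally show ?thesis .
qed

text \<open>Schur triangularization: the trace is invariant under similarity, and the diagonal of a
  triangular form consists of eigenvalues.\<close>

lemma trace_single_eigenvalue:
  fixes M :: "complex mat"
  assumes M: "M \<in> carrier_mat n n" and single: "\<And>l. eigenvalue M l \<Longrightarrow> l = c"
  shows "(\<Sum>i<n. M $$ (i, i)) = of_nat n * c"
proof -
  obtain es where "char_poly M = (\<Prod>a\<leftarrow>es. [:- a, 1:])" using char_poly_factorized[OF M] by auto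
  then obtain B where B: "B \<in> carrier_mat n n" and ut: "upper_triangular B" and sim: "similar_mat M B"
    using schur_decomposition_exists[OF M] by blast
  obtain P Q where wit: "similar_mat_wit M B P Q" using sim by (auto simp: similar_mat_def)
  then have PQ: "P \<in> carrier_mat n n" "Q \<in> carrier_mat n n" "Q * P = 1\<^sub>m n" "M = P * B * Q"
    using M by (auto simp: similar_mat_wit_def Let_def)
  have "(\<Sum>i<n. M $$ (i, i)) = (\<Sum>i<n. (Q * (P * B)) $$ (i, i))"
    unfolding PQ(4) by (rule trace_mult_commute) (use PQ B in auto)
  also have "Q * (P * B) = B" using assoc_mult_mat[OF PQ(2,1) B] PQ(3) B by simp
  also have "(\<Sum>i<n. B $$ (i, i)) = (\<Sum>i<n. c)"
  proof (rule sum.cong)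
    fix i assume "i \<in> {..<n}"
    then have "B $$ (i, i) \<in> set (diag_mat B)" using B by (auto simp: diag_mat_def)
    then have "poly (char_poly M) (B $$ (i, i)) = 0"
      unfolding char_poly_similar[OF sim] char_poly_upper_triangular[OF B ut]
      by (rule linear_poly_root)
    then show "B $$ (i, i) = c" using single eigenvalue_root_char_poly[OF M] by simp
  qed simp
  finally show ?thesis by simp
qed

section \<open>Positive matrices acting on the Hilbert metric\<close>

locale positive_matrix =
  fixes n :: nat and A :: "real mat"
  assumes n: "2 \<le> n"
    and A: "A \<in> carrier_mat n n"
    and pos: "\<And>i j. i < n \<Longrightarrow> j < n \<Longrightarrow> 0 < A $$ (i, j)"
begin

lemma n0: "0 < n" using n by simp

text \<open>One positive entry of \<open>y\<close> already contributes a positive term to every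
  coordinate of the product.\<close>

lemma mult_pos_vec:
  assumes "y \<in> carrier_vec n" "\<And>i. i < n \<Longrightarrow> 0 \<le> y $ i" "k < n" "y $ k \<noteq> 0"
  shows "A *\<^sub>v y \<in> pos_vecs n"
proof -
  have "0 < (A *\<^sub>v y) $ i" if i: "i < n" for i
  proof -
    have "0 < y $ k" using assms(2)[OF assms(3)] assms(4) by linarith
    then have "0 < A $$ (i,k) * y $ k" using pos i assms(3) by simp
    moreover have "\<And>j. j < n \<Longrightarrow> 0 \<le> A $$ (i,j) * y $ j"
      using pos i assms(2) by (simp add: less_imp_le)
    ultimately have "0 < (\<Sum>j<n. A $$ (i,j) * y $ j)"
      using assms(3) by (intro sum_pos2[of _ k]) auto
    then show ?thesis using mult_mat_vec_index[OF A assms(1) i] by simp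
  qed
  then show ?thesis using A assms(1) by (auto simp: pos_vecs_def simp del: index_mult_mat_vec)
qed

lemma mult_pos_vecs: "v \<in> pos_vecs n \<Longrightarrow> A *\<^sub>v v \<in> pos_vecs n"
  using mult_pos_vec[of v 0] n0 by (force dest: pos_vecsD simp: less_imp_le)

text \<open>With \<open>M\<close> and \<open>m\<close> the extreme ratios of \<open>w\<close> to
  \<open>v\<close>, the sandwich of \<open>w\<close> between \<open>m\<close> and \<open>M\<close>
  times \<open>v\<close> survives multiplication by \<open>A\<close>, so no cross ratio of the
  images exceeds \<open>M / m\<close>.\<close>

lemma hilbert_dist_mult_le:
  assumes v: "v \<in> pos_vecs n" and w: "w \<in> pos_vecs n"
  shows "hilbert_dist (A *\<^sub>v v) (A *\<^sub>v w) \<le> hilbert_dist v w"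
proof -
  note V = pos_vecsD[OF v] and W = pos_vecsD[OF w]
  define r where "r k = w $ k / v $ k" for k
  define M where "M = Max (r ` {..<n})"
  define m where "m = Min (r ` {..<n})"
  have ne: "r ` {..<n} \<noteq> {}" using n0 by auto
  obtain a where a: "a < n" "M = r a" using Max_in[OF _ ne] unfolding M_def by auto
  obtain b where b: "b < n" "m = r b" using Min_in[OF _ ne] unfolding m_def by auto
  have wM: "w $ k \<le> M * v $ k" and wm: "m * v $ k \<le> w $ k" if "k < n" for k
  proof -
    have "r k \<le> M" "m \<le> r k" using that by (auto simp: M_def m_def)
    then show "w $ k \<le> M * v $ k" "m * v $ k \<le> w $ k"
      using V(3)[OF that] by (auto simp: r_def field_simps)
  qed
  have m0: "0 < m" and M0: "0 < M" using a b V(3) W(3) by (auto simp: r_def)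
  note AV = pos_vecsD[OF mult_pos_vecs[OF v]] and AW = pos_vecsD[OF mult_pos_vecs[OF w]]
  have AM: "(A *\<^sub>v w) $ i \<le> M * (A *\<^sub>v v) $ i" and Am: "m * (A *\<^sub>v v) $ i \<le> (A *\<^sub>v w) $ i"
    if i: "i < n" for i
  proof -
    have p: "0 \<le> A $$ (i,j)" if "j < n" for j using pos[OF i that] by simp
    show "(A *\<^sub>v w) $ i \<le> M * (A *\<^sub>v v) $ i"
      unfolding mult_mat_vec_index[OF A W(1) i] mult_mat_vec_index[OF A V(1) i] sum_distrib_left
      by (rule sum_mono) (use mult_left_mono[OF wM p] in \<open>auto simp: algebra_simps\<close>)
    show "m * (A *\<^sub>v v) $ i \<le> (A *\<^sub>v w) $ i"
      unfolding mult_mat_vec_index[OF A W(1) i] mult_mat_vec_index[OF A V(1) i] sum_distrib_left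
      by (rule sum_mono) (use mult_left_mono[OF wm p] in \<open>auto simp: algebra_simps\<close>)
  qed
  have D: "ln (M / m) \<le> hilbert_dist v w"
  proof -
    have "M / m = (w $ a / w $ b) / (v $ a / v $ b)" by (simp add: a b r_def field_simps)
    then show ?thesis using hilbert_dist_ge[of a v b w] a b V by simp
  qed
  show ?thesis
  proof (rule hilbert_dist_le)
    show "0 < dim_vec (A *\<^sub>v v)" using A n0 by simp
    fix i j assume ij: "i < dim_vec (A *\<^sub>v v)" "j < dim_vec (A *\<^sub>v v)"
    then have i: "i < n" and j: "j < n" using A by auto
    have q1: "(A *\<^sub>v w) $ i / (A *\<^sub>v v) $ i \<le> M" using AM[OF i] AV(3)[OF i] by (simp add: field_simps)
    have q2: "m \<le> (A *\<^sub>v w) $ j / (A *\<^sub>v v) $ j" using Am[OF j] AV(3)[OF j] by (simp add: field_simps)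
    have "((A *\<^sub>v w) $ i / (A *\<^sub>v w) $ j) / ((A *\<^sub>v v) $ i / (A *\<^sub>v v) $ j)
        = ((A *\<^sub>v w) $ i / (A *\<^sub>v v) $ i) / ((A *\<^sub>v w) $ j / (A *\<^sub>v v) $ j)"
      by (simp add: field_simps)
    also have "\<dots> \<le> M / m" using frac_le[OF _ q1 m0 q2] M0 by simp
    finally have "ln (((A *\<^sub>v w) $ i / (A *\<^sub>v w) $ j) / ((A *\<^sub>v v) $ i / (A *\<^sub>v v) $ j)) \<le> ln (M / m)"
      using AV(3) AW(3) i j M0 m0 by (subst ln_le_cancel_iff) auto
    with D show "ln (((A *\<^sub>v w) $ i / (A *\<^sub>v w) $ j) / ((A *\<^sub>v v) $ i / (A *\<^sub>v v) $ j)) \<le> hilbert_dist v w"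
      by linarith
  qed
qed

lemma hilbert_dist_induced_map:
  assumes "v \<in> pos_vecs n" "w \<in> pos_vecs n"
  shows "hilbert_dist (induced_map A v) (induced_map A w) = hilbert_dist (A *\<^sub>v v) (A *\<^sub>v w)"
proof -
  obtain a where a: "0 < a" "induced_map A v = a \<cdot>\<^sub>v (A *\<^sub>v v)"
    unfolding induced_map_def by (rule normalize_vec_eq_smult[OF mult_pos_vecs[OF assms(1)] n0])
  obtain b where b: "0 < b" "induced_map A w = b \<cdot>\<^sub>v (A *\<^sub>v w)"
    unfolding induced_map_def by (rule normalize_vec_eq_smult[OF mult_pos_vecs[OF assms(2)] n0])
  show ?thesis using a b by (simp add: hilbert_dist_smult)
qed

text \<open>A real \<open>Sup\<close> dominates its members only if the set is bounded above;
  nonexpansiveness supplies the bound 1.\<close>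

lemma ratio_le_birkhoff_coeff:
  assumes "v \<in> simplex_interior n" "w \<in> simplex_interior n" "v \<noteq> w"
  shows "hilbert_dist (A *\<^sub>v v) (A *\<^sub>v w) / hilbert_dist v w \<le> birkhoff_coeff A"
  unfolding birkhoff_coeff_def
proof (rule cSup_upper)
  show "hilbert_dist (A *\<^sub>v v) (A *\<^sub>v w) / hilbert_dist v w \<in>
    {hilbert_dist (induced_map A v) (induced_map A w) / hilbert_dist v w | v w.
       v \<in> simplex_interior (dim_col A) \<and> w \<in> simplex_interior (dim_col A) \<and> v \<noteq> w}"
    using assms A hilbert_dist_induced_map[OF subsetD[OF simplex_interior_pos_vecs] subsetD[OF simplex_interior_pos_vecs]]
    by (intro CollectI exI[of _ v] exI[of _ w]) auto
  show "bdd_above {hilbert_dist (induced_map A v) (induced_map A w) / hilbert_dist v w | v w.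
       v \<in> simplex_interior (dim_col A) \<and> w \<in> simplex_interior (dim_col A) \<and> v \<noteq> w}"
  proof (rule bdd_aboveI[of _ 1], clarify)
    fix v w assume "v \<in> simplex_interior (dim_col A)" "w \<in> simplex_interior (dim_col A)"
    then have vw: "v \<in> pos_vecs n" "w \<in> pos_vecs n" using A simplex_interior_pos_vecs by auto
    show "hilbert_dist (induced_map A v) (induced_map A w) / hilbert_dist v w \<le> 1"
      using hilbert_dist_mult_le[OF vw] hilbert_dist_nonneg[OF vw n0]
      by (auto simp: hilbert_dist_induced_map[OF vw] divide_le_eq_1)
  qed
qed

text \<open>It suffices to exhibit one pair of distinct simplex points, since its quotient is
  nonnegative.\<close>

lemma birkhoff_coeff_nonneg: "0 \<le> birkhoff_coeff A"
proof -
  \<comment> \<open>Not proportional: entries 0 and 1 agree in \<open>v\<close> and differ in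
    \<open>w\<close>.\<close>
  define v w where "v = vec n (\<lambda>_. 1 :: real)" and "w = vec n (\<lambda>i. real i + 1)"
  have vw: "v \<in> pos_vecs n" "w \<in> pos_vecs n" by (auto simp: v_def w_def pos_vecs_def)
  obtain a where a: "0 < a" "normalize_vec v = a \<cdot>\<^sub>v v" using normalize_vec_eq_smult[OF vw(1) n0] .
  obtain b where b: "0 < b" "normalize_vec w = b \<cdot>\<^sub>v w" using normalize_vec_eq_smult[OF vw(2) n0] .
  have ne: "normalize_vec v \<noteq> normalize_vec w"
  proof
    assume eq: "normalize_vec v = normalize_vec w"
    have "normalize_vec v $ 0 = normalize_vec v $ 1" using n by (subst (1 2) a(2)) (simp add: v_def)
    then have "normalize_vec w $ 0 = normalize_vec w $ 1" by (simp add: eq)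
    then show False using b(1) n unfolding b(2) by (simp add: w_def)
  qed
  note s = normalize_vec_simplex[OF vw(1) n0] normalize_vec_simplex[OF vw(2) n0]
  have p: "normalize_vec v \<in> pos_vecs n" "normalize_vec w \<in> pos_vecs n"
    using s simplex_interior_pos_vecs by auto
  have "0 \<le> hilbert_dist (A *\<^sub>v normalize_vec v) (A *\<^sub>v normalize_vec w)
      / hilbert_dist (normalize_vec v) (normalize_vec w)"
    using hilbert_dist_nonneg[OF p n0] hilbert_dist_nonneg[OF p[THEN mult_pos_vecs] n0] by simp
  then show ?thesis using ratio_le_birkhoff_coeff[OF s ne] by linarith
qed

lemma hilbert_dist_mult_contract:
  assumes v: "v \<in> pos_vecs n" and w: "w \<in> pos_vecs n"
  shows "hilbert_dist (A *\<^sub>v v) (A *\<^sub>v w) \<le> birkhoff_coeff A * hilbert_dist v w"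
proof -
  obtain a where a: "0 < a" "normalize_vec v = a \<cdot>\<^sub>v v" using normalize_vec_eq_smult[OF v n0] .
  obtain b where b: "0 < b" "normalize_vec w = b \<cdot>\<^sub>v w" using normalize_vec_eq_smult[OF w n0] .
  define v' w' where "v' = normalize_vec v" and "w' = normalize_vec w"
  have s: "v' \<in> simplex_interior n" "w' \<in> simplex_interior n"
    unfolding v'_def w'_def using normalize_vec_simplex v w n0 by auto
  then have p: "v' \<in> pos_vecs n" "w' \<in> pos_vecs n" using simplex_interior_pos_vecs by auto
  have d: "hilbert_dist v' w' = hilbert_dist v w"
    using a b pos_vecsD(2)[OF v] pos_vecsD(2)[OF w] by (simp add: v'_def w'_def hilbert_dist_smult)
  have dA: "hilbert_dist (A *\<^sub>v v') (A *\<^sub>v w') = hilbert_dist (A *\<^sub>v v) (A *\<^sub>v w)"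
    using a b mult_mat_vec[OF A pos_vecsD(1)[OF v]] mult_mat_vec[OF A pos_vecsD(1)[OF w]]
    by (simp add: v'_def w'_def hilbert_dist_smult)
  show ?thesis
  \<comment> \<open>At distance 0 the quotient says nothing, so nonexpansiveness is used
    instead.\<close>
  proof (cases "hilbert_dist v w = 0")
    case True
    then show ?thesis using hilbert_dist_mult_le[OF v w] by simp
  next
    case False
    then have "0 < hilbert_dist v w" using hilbert_dist_nonneg[OF v w n0] by simp
    moreover have "v' \<noteq> w'" using False hilbert_dist_self[OF p(1) n0] d by auto
    ultimately show ?thesis
      using ratio_le_birkhoff_coeff[OF s] by (simp add: d dA divide_le_eq)
  qed
qed


section \<open>Perron's theorem\<close>

abbreviation "C \<equiv> map_mat complex_of_real A"

abbreviation "r \<equiv> spectral_radius C"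

lemma C: "C \<in> carrier_mat n n"
  using A by simp

lemma r_nonneg: "0 \<le> r"
  using spectral_radius_mem_max(1)[OF C n0] by auto

lemma cmod_eigenvalue_le: "eigenvalue C l \<Longrightarrow> cmod l \<le> r"
  by (rule spectral_radius_mem_max(2)[OF C n0]) (auto simp: spectrum_def)

text \<open>A nonzero defect \<open>z\<close> is nonnegative, so \<open>A\<close> makes it strictly
  positive. Then \<open>y'\<close> satisfies the inequality strictly in every entry, which leaves
  room for a factor \<open>s\<close> above \<open>r\<close>.\<close>

lemma subinvariant_eq:
  assumes y: "y \<in> carrier_vec n" "\<And>i. i < n \<Longrightarrow> 0 \<le> y $ i" "k < n" "y $ k \<noteq> 0"
    and sub: "\<And>i. i < n \<Longrightarrow> r * y $ i \<le> (A *\<^sub>v y) $ i"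
  shows "A *\<^sub>v y = r \<cdot>\<^sub>v y"
proof (rule ccontr)
  assume ne: "A *\<^sub>v y \<noteq> r \<cdot>\<^sub>v y"
  define y' where "y' = A *\<^sub>v y"
  define z where "z = y' - r \<cdot>\<^sub>v y"
  have y': "y' \<in> pos_vecs n" unfolding y'_def by (rule mult_pos_vec[OF y])
  note Y' = pos_vecsD[OF y']
  have z: "z \<in> carrier_vec n" using y(1) Y'(1) by (simp add: z_def)
  obtain i where i: "i < n" "y' $ i \<noteq> r * y $ i"
    using ne y(1) A by (auto simp: y'_def vec_eq_iff simp del: index_mult_mat_vec)
  have "A *\<^sub>v z \<in> pos_vecs n"
    by (rule mult_pos_vec[OF z _ i(1)])
      (use i y(1) Y' sub in \<open>auto simp: z_def y'_def simp del: index_mult_mat_vec\<close>)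
  moreover have "A *\<^sub>v z = A *\<^sub>v y' - r \<cdot>\<^sub>v y'"
    unfolding z_def using y(1) Y'(1) A
    by (simp add: mult_minus_distrib_mat_vec mult_mat_vec y'_def)
  ultimately have gt: "r * y' $ j < (A *\<^sub>v y') $ j" if "j < n" for j
    using pos_vecsD(3)[of "A *\<^sub>v z" n j] that Y'(1) A by (simp del: index_mult_mat_vec)
  define s where "s = Min ((\<lambda>j. (A *\<^sub>v y') $ j / y' $ j) ` {..<n})"
  have "s \<in> (\<lambda>j. (A *\<^sub>v y') $ j / y' $ j) ` {..<n}"
    unfolding s_def by (rule Min_in) (use n0 in auto)
  then have "r < s" using gt Y'(3) by (auto simp: less_divide_eq simp del: index_mult_mat_vec)
  moreover have "s * y' $ j \<le> (A *\<^sub>v y') $ j" if j: "j < n" for j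
  proof -
    have "s \<le> (A *\<^sub>v y') $ j / y' $ j" unfolding s_def by (rule Min_le) (use j in auto)
    then show ?thesis using Y'(3)[OF j] by (simp add: le_divide_eq del: index_mult_mat_vec)
  qed
  then have "s \<le> r"
    by (intro spectral_radius_ge_subinvariant[OF A less_imp_le[OF pos] Y'(1)]) (use n0 Y'(3) in auto)
  ultimately show False by simp
qed

text \<open>The triangle inequality in each row of the eigenvalue equation makes \<open>y\<close>
  subinvariant, and \<open>subinvariant_eq\<close> upgrades this to equality.\<close>

lemma max_modulus_eigenvector:
  assumes x: "eigenvector C x l" and l: "cmod l = r"
  defines "y \<equiv> vec n (\<lambda>i. cmod (x $ i))"
  shows "A *\<^sub>v y = r \<cdot>\<^sub>v y" "y \<in> pos_vecs n" "0 < r"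
proof -
  have xc: "x \<in> carrier_vec n" and x0: "x \<noteq> 0\<^sub>v n" and Cx: "C *\<^sub>v x = l \<cdot>\<^sub>v x"
    using x A by (auto simp: eigenvector_def)
  have y: "y \<in> carrier_vec n" by (simp add: y_def)
  obtain k where k: "k < n" "y $ k \<noteq> 0" using x0 xc by (auto simp: y_def vec_eq_iff)
  have y0: "0 \<le> y $ i" if "i < n" for i using that by (simp add: y_def)
  have sub: "r * y $ i \<le> (A *\<^sub>v y) $ i" if i: "i < n" for i
  proof -
    have "r * y $ i = cmod ((C *\<^sub>v x) $ i)"
      unfolding Cx using i xc l by (simp add: y_def norm_mult)
    also have "\<dots> = cmod (\<Sum>j<n. C $$ (i, j) * x $ j)" by (simp only: mult_mat_vec_index[OF C xc i])
    also have "\<dots> \<le> (\<Sum>j<n. cmod (C $$ (i, j) * x $ j))" by (rule norm_sum)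
    also have "\<dots> = (\<Sum>j<n. A $$ (i, j) * y $ j)"
      by (rule sum.cong) (use A i pos[OF i] in \<open>auto simp: y_def norm_mult less_imp_le\<close>)
    finally show ?thesis using mult_mat_vec_index[OF A y i] by simp
  qed
  show eq: "A *\<^sub>v y = r \<cdot>\<^sub>v y" by (rule subinvariant_eq[OF y y0 k sub])
  \<comment> \<open>Positivity of the product yields both \<open>0 < r\<close> and
    \<open>0 < y $ i\<close>, as neither factor is negative.\<close>
  have p: "0 < r * y $ i" if i: "i < n" for i
    using pos_vecsD(3)[OF mult_pos_vec[OF y y0 k] i] eq i y by simp
  then show "y \<in> pos_vecs n" "0 < r"
    using y y0 n0 r_nonneg by (auto simp: pos_vecs_def zero_less_mult_iff)
qed

text \<open>Equality holds in the triangle inequality for row 0, whose coefficients are all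
  positive, so the entries of \<open>x\<close> share one phase. Rotating it away turns
  \<open>x\<close> into the positive vector \<open>y\<close>.\<close>

lemma perron_eigenvalue_unique:
  assumes "eigenvalue C l" "cmod l = r"
  shows "l = of_real r"
proof -
  obtain x where x: "eigenvector C x l" using assms by (auto simp: eigenvalue_def)
  then have xc: "x \<in> carrier_vec n" and Cx: "C *\<^sub>v x = l \<cdot>\<^sub>v x"
    using A by (auto simp: eigenvector_def)
  define y where "y = vec n (\<lambda>i. cmod (x $ i))"
  have Ay: "A *\<^sub>v y = r \<cdot>\<^sub>v y" and y: "y \<in> pos_vecs n" and r: "0 < r"
    using max_modulus_eigenvector[OF x assms(2)] by (auto simp: y_def)
  note Y = pos_vecsD[OF y]
  define S where "S = (\<Sum>j<n. A $$ (0, j) * x $ j)"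
  have S: "S = l * x $ 0"
  proof -
    have "(C *\<^sub>v x) $ 0 = (\<Sum>j<n. C $$ (0, j) * x $ j)" by (rule mult_mat_vec_index[OF C xc n0])
    also have "\<dots> = S" unfolding S_def by (rule sum.cong) (use A n0 in auto)
    finally show ?thesis unfolding Cx using xc n0 by simp
  qed
  have cS: "cmod S = (\<Sum>j<n. A $$ (0, j) * cmod (x $ j))"
  proof -
    have "cmod S = (A *\<^sub>v y) $ 0" unfolding Ay S using n0 assms(2) by (simp add: norm_mult y_def)
    then show ?thesis unfolding mult_mat_vec_index[OF A Y(1) n0] by (simp add: y_def)
  qed
  have S0: "S \<noteq> 0"
    using Y(3)[OF n0] n0 r assms(2) by (auto simp: S y_def)
  define c where "c = cnj (sgn S)"
  have c: "cmod c = 1" using S0 by (simp add: c_def norm_sgn)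
  have cSS: "c * S = of_real (cmod S)" unfolding c_def by (rule cnj_sgn_mult)
  have Re: "Re (c * x $ j) = cmod (x $ j)" if j: "j < n" for j
  proof -
    \<comment> \<open>These nonnegative terms will sum to 0, so each of them vanishes.\<close>
    have nn: "0 \<le> A $$ (0, j) * (cmod (x $ j) - Re (c * x $ j))" if "j < n" for j
      using pos[OF n0 that] complex_Re_le_cmod[of "c * x $ j"] c by (simp add: norm_mult)
    have "Re (c * S) = (\<Sum>j<n. A $$ (0, j) * Re (c * x $ j))"
      unfolding S_def sum_distrib_left Re_sum
      by (rule sum.cong) (simp_all add: algebra_simps)
    then have "(\<Sum>j<n. A $$ (0, j) * (cmod (x $ j) - Re (c * x $ j))) = 0"
      using cS by (simp add: cSS right_diff_distrib sum_subtractf)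
    then have "A $$ (0, j) * (cmod (x $ j) - Re (c * x $ j)) = 0"
      using nn j by (subst (asm) sum_nonneg_eq_0_iff) auto
    then show ?thesis using pos[OF n0 j] by simp
  qed
  have cx: "c * x $ j = of_real (y $ j)" if j: "j < n" for j
  proof -
    have "cmod (c * x $ j) = Re (c * x $ j)" using Re[OF j] c by (simp add: norm_mult)
    then have "Im (c * x $ j) = 0" using cmod_power2[of "c * x $ j"] by simp
    then show ?thesis using Re[OF j] j by (simp add: complex_eq_iff y_def)
  qed
  \<comment> \<open>Coordinate 0 of the rotated eigenvalue equation determines
    \<open>l\<close>.\<close>
  have "l * (c * x $ 0) = c * S" by (simp add: S)
  also have "\<dots> = of_real (cmod S)" by (rule cSS)
  also have "cmod S = r * y $ 0" using n0 assms(2) by (simp add: S norm_mult y_def)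
  finally show ?thesis using cx[OF n0] Y(3)[OF n0] by simp
qed

lemma perron_vector:
  obtains u where "u \<in> pos_vecs n" "A *\<^sub>v u = r \<cdot>\<^sub>v u" "eigenvalue C (of_real r)" "0 < r"
proof -
  obtain l where l: "eigenvalue C l" "cmod l = r"
    using spectral_radius_mem_max(1)[OF C n0] by (auto simp: spectrum_def)
  then obtain x where "eigenvector C x l" by (auto simp: eigenvalue_def)
  from max_modulus_eigenvector[OF this l(2)] perron_eigenvalue_unique[OF l] l(1) show ?thesis
    using that by auto
qed

lemma perron_root_eq: "perron_root A = r"
proof -
  obtain u where e: "eigenvalue C (of_real r)" using perron_vector by blast
  have "(THE l. eigenvalue C l \<and> (\<forall>m. eigenvalue C m \<longrightarrow> cmod m \<le> cmod l)) = of_real r"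
  proof (rule the_equality)
    show "eigenvalue C (of_real r) \<and> (\<forall>m. eigenvalue C m \<longrightarrow> cmod m \<le> cmod (of_real r))"
      using e cmod_eigenvalue_le r_nonneg by simp
    fix l assume l: "eigenvalue C l \<and> (\<forall>m. eigenvalue C m \<longrightarrow> cmod m \<le> cmod l)"
    then have "r \<le> cmod l" using e r_nonneg by (metis norm_of_real abs_of_nonneg)
    then show "l = of_real r" using l cmod_eigenvalue_le perron_eigenvalue_unique by (simp add: order_antisym)
  qed
  then show ?thesis unfolding perron_root_def by simp
qed


section \<open>Existence of a second eigenvalue\<close>

lemma other_eigenvalue: "\<exists>l. eigenvalue C l \<and> l \<noteq> of_real r"
proof (rule ccontr)
  assume "\<not> ?thesis"
  then have "(\<Sum>i<n. C $$ (i, i)) = of_nat n * of_real r"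
    by (intro trace_single_eigenvalue[OF C]) auto
  moreover have "(\<Sum>i<n. C $$ (i, i)) = of_real (\<Sum>i<n. A $$ (i, i))"
    unfolding of_real_sum by (rule sum.cong) (use A in auto)
  ultimately have "complex_of_real (\<Sum>i<n. A $$ (i, i)) = of_real (of_nat n * r)" by simp
  then have tr: "(\<Sum>i<n. A $$ (i, i)) = of_nat n * r" by (simp only: of_real_eq_iff)
  obtain u where u: "u \<in> pos_vecs n" "A *\<^sub>v u = r \<cdot>\<^sub>v u" by (rule perron_vector)
  note U = pos_vecsD[OF u(1)]
  have "A $$ (i, i) < r" if i: "i < n" for i
  proof -
    \<comment> \<open>A second index exists because \<open>2 \<le> n\<close>; its positive
      off-diagonal term makes the inequality strict.\<close>
    obtain j where j: "j < n" "j \<noteq> i" using that[of "if i = 0 then 1 else 0"] n by auto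
    have "A $$ (i, i) * u $ i < (\<Sum>k\<in>{i, j}. A $$ (i, k) * u $ k)"
      using pos[OF i j(1)] U(3)[OF j(1)] j(2) by simp
    also have "\<dots> \<le> (\<Sum>k<n. A $$ (i, k) * u $ k)"
      by (rule sum_mono2) (use i j pos U(3) in \<open>auto intro!: mult_nonneg_nonneg less_imp_le\<close>)
    also have "\<dots> = r * u $ i" using mult_mat_vec_index[OF A U(1) i] u(2) i U(2) by simp
    finally show ?thesis using U(3)[OF i] by simp
  qed
  then have "(\<Sum>i<n. A $$ (i, i)) < (\<Sum>i<n. r)" using n0 by (intro sum_strict_mono) auto
  then show False using tr by simp
qed

section \<open>From metric contraction to the eigenvalue bound\<close>

text \<open>The infinitesimal form, at the fixed point \<open>u\<close>, of the contraction of the Hilbert metric: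
  to first order \<open>hilbert_dist u (u + e \<cdot>\<^sub>v z)\<close> is \<open>e\<close> times the oscillation of \<open>z / u\<close>.\<close>

lemma oscillation_contract:
  assumes u: "u \<in> pos_vecs n" "A *\<^sub>v u = r \<cdot>\<^sub>v u" and r: "0 < r" and z: "z \<in> carrier_vec n"
    and osc: "\<And>k l. k < n \<Longrightarrow> l < n \<Longrightarrow> z $ k / u $ k - z $ l / u $ l \<le> D"
    and i: "i < n" and j: "j < n"
  shows "(A *\<^sub>v z) $ i / u $ i - (A *\<^sub>v z) $ j / u $ j \<le> r * (birkhoff_coeff A * D)"
proof -
  let ?t = "birkhoff_coeff A"
  note U = pos_vecsD[OF u(1)]
  define R where "R k = z $ k / u $ k" for k
  define M where "M = Max (R ` {..<n})"
  define m where "m = Min (R ` {..<n})"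
  have ne: "R ` {..<n} \<noteq> {}" using n0 by auto
  have RM: "R k \<le> M" and mR: "m \<le> R k" if "k < n" for k using that by (auto simp: M_def m_def)
  have MD: "M - m \<le> D"
    using Max_in[OF _ ne] Min_in[OF _ ne] osc unfolding M_def[symmetric] m_def[symmetric]
    by (auto simp: R_def)
  \<comment> \<open>The derivatives at \<open>e = 0\<close> of the logarithms of entries
    \<open>i\<close> and \<open>j\<close> of \<open>A\<close> applied to
    \<open>u + e \<cdot>\<^sub>v z\<close>; the denominators come from
    \<open>A *\<^sub>v u = r \<cdot>\<^sub>v u\<close>.\<close>
  define p q where "p = (A *\<^sub>v z) $ i / (r * u $ i)" and "q = (A *\<^sub>v z) $ j / (r * u $ j)"
  \<comment> \<open>The slack in the contraction inequality along this segment. It vanishes at 0 and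
    is nonnegative for small positive \<open>e\<close>, so its derivative at 0 cannot be
    negative.\<close>
  define g where "g e = ?t * (ln (1 + e * M) - ln (1 + e * m)) - (ln (1 + e * p) - ln (1 + e * q))" for e
  \<comment> \<open>The bound on \<open>e\<close> gives \<open>0 < 1 + e * m\<close>, which keeps
    \<open>w\<close> in the positive cone.\<close>
  have g_nonneg: "0 \<le> g e" if e: "0 < e" "e < 1 / (1 + \<bar>m\<bar>)" for e
  proof -
    have "e * \<bar>m\<bar> < 1" using e by (simp add: field_simps)
    then have em: "0 < 1 + e * m" using e(1) abs_ge_minus_self[of "e * m"] by (simp add: abs_mult)
    define w where "w = u + e \<cdot>\<^sub>v z"
    have wk: "w $ k = u $ k * (1 + e * R k)" if "k < n" for k
      using that U(1) U(3)[OF that] z by (simp add: w_def R_def field_simps)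
    have le: "1 + e * m \<le> 1 + e * R k" "1 + e * R k \<le> 1 + e * M" if "k < n" for k
      using mR[OF that] RM[OF that] e(1) by auto
    have w: "w \<in> pos_vecs n"
      using U(1) z wk le em U(3) by (force simp: w_def pos_vecs_def)
    note AW = pos_vecsD[OF mult_pos_vecs[OF w]]
    have Awk: "(A *\<^sub>v w) $ k = r * u $ k * (1 + e * ((A *\<^sub>v z) $ k / (r * u $ k)))" if "k < n" for k
    proof -
      have "A *\<^sub>v w = r \<cdot>\<^sub>v u + e \<cdot>\<^sub>v (A *\<^sub>v z)"
        unfolding w_def using mult_add_distrib_mat_vec[OF A U(1), of "e \<cdot>\<^sub>v z"] mult_mat_vec[OF A z] z u(2)
        by simp
      then have "(A *\<^sub>v w) $ k = r * u $ k + e * (A *\<^sub>v z) $ k"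
        using that U(1) A z by (simp del: index_mult_mat_vec)
      then show ?thesis using r U(3)[OF that] by (simp add: field_simps del: index_mult_mat_vec)
    qed
    have pq: "0 < 1 + e * p" "0 < 1 + e * q"
      unfolding p_def q_def
      by (rule zero_less_mult_pos[OF AW(3)[OF i, unfolded Awk[OF i]] mult_pos_pos[OF r U(3)[OF i]]],
        rule zero_less_mult_pos[OF AW(3)[OF j, unfolded Awk[OF j]] mult_pos_pos[OF r U(3)[OF j]]])
    have "ln (1 + e * p) - ln (1 + e * q) = ln ((1 + e * p) / (1 + e * q))"
      using pq by (simp add: ln_div)
    also have "(1 + e * p) / (1 + e * q)
        = ((A *\<^sub>v w) $ i / (A *\<^sub>v w) $ j) / ((A *\<^sub>v u) $ i / (A *\<^sub>v u) $ j)"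
      unfolding Awk[OF i] Awk[OF j] u(2) p_def[symmetric] q_def[symmetric]
      using i j U(2) U(3)[OF i] U(3)[OF j] r by simp
    also have "ln \<dots> \<le> hilbert_dist (A *\<^sub>v u) (A *\<^sub>v w)"
      by (rule hilbert_dist_ge) (use i j A in auto)
    also have "\<dots> \<le> ?t * hilbert_dist u w" by (rule hilbert_dist_mult_contract[OF u(1) w])
    also have "\<dots> \<le> ?t * (ln (1 + e * M) - ln (1 + e * m))"
    proof (rule mult_left_mono[OF hilbert_dist_le birkhoff_coeff_nonneg])
      fix k l assume "k < dim_vec u" "l < dim_vec u"
      then have k: "k < n" and l: "l < n" using U(2) by auto
      have "(w $ k / w $ l) / (u $ k / u $ l) = (1 + e * R k) / (1 + e * R l)"
        unfolding wk[OF k] wk[OF l] using U(3)[OF k] U(3)[OF l] by simp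
      then have "ln ((w $ k / w $ l) / (u $ k / u $ l)) = ln ((1 + e * R k) / (1 + e * R l))" by simp
      also have "ln ((1 + e * R k) / (1 + e * R l)) = ln (1 + e * R k) - ln (1 + e * R l)"
        using le(1)[OF k] le(1)[OF l] em by (subst ln_div) auto
      also have "\<dots> \<le> ln (1 + e * M) - ln (1 + e * m)" by (rule diff_mono)
        (use le[OF k] le[OF l] em in \<open>auto intro!: ln_mono\<close>)
      finally show "ln ((w $ k / w $ l) / (u $ k / u $ l)) \<le> ln (1 + e * M) - ln (1 + e * m)" .
    qed (use U(2) n0 in simp)
    finally show ?thesis by (simp add: g_def)
  qed
  have "DERIV g 0 :> ?t * (M - m) - (p - q)"
    unfolding g_def by (auto intro!: derivative_eq_intros)
  moreover have "\<not> ?t * (M - m) - (p - q) < 0"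
  proof
    assume "?t * (M - m) - (p - q) < 0"
    from DERIV_neg_dec_right[OF \<open>DERIV g 0 :> ?t * (M - m) - (p - q)\<close> this]
    obtain d where d: "0 < d" "\<And>h. 0 < h \<Longrightarrow> h < d \<Longrightarrow> g (0 + h) < g 0" by blast
    have "0 < min d (1 / (1 + \<bar>m\<bar>))" using d(1) by (simp add: add_pos_nonneg)
    then obtain e where "0 < e" "e < min d (1 / (1 + \<bar>m\<bar>))" using dense by blast
    then show False using g_nonneg[of e] d(2)[of e] by (simp add: g_def)
  qed
  ultimately have "p - q \<le> ?t * (M - m)" by simp
  also have "\<dots> \<le> ?t * D" by (rule mult_left_mono[OF MD birkhoff_coeff_nonneg])
  finally have "r * (p - q) \<le> r * (?t * D)" using r by simp
  moreover have "r * (p - q) = (A *\<^sub>v z) $ i / u $ i - (A *\<^sub>v z) $ j / u $ j"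
    using r U(3)[OF i] U(3)[OF j] by (simp add: p_def q_def field_simps del: index_mult_mat_vec)
  ultimately show ?thesis by simp
qed

lemma cmod_other_eigenvalue_le:
  assumes l: "eigenvalue C l" "l \<noteq> of_real r"
  shows "cmod l \<le> r * birkhoff_coeff A"
proof -
  obtain u where u: "u \<in> pos_vecs n" "A *\<^sub>v u = r \<cdot>\<^sub>v u" and r: "0 < r" by (rule perron_vector)
  note U = pos_vecsD[OF u(1)]
  obtain x where "eigenvector C x l" using l by (auto simp: eigenvalue_def)
  then have xc: "x \<in> carrier_vec n" and x0: "x \<noteq> 0\<^sub>v n" and Cx: "C *\<^sub>v x = l \<cdot>\<^sub>v x"
    using A by (auto simp: eigenvector_def)
  define g where "g k = x $ k / of_real (u $ k)" for k
  \<comment> \<open>The diameter of the points \<open>g k\<close> in the complex plane, attained at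
    the pair \<open>i\<close>, \<open>j\<close>.\<close>
  define D where "D = Max ((\<lambda>(k, l). cmod (g k - g l)) ` ({..<n} \<times> {..<n}))"
  have D_ge: "cmod (g k - g l) \<le> D" if "k < n" "l < n" for k l
    unfolding D_def by (rule Max_ge) (use that in force)+
  have "D \<in> (\<lambda>(k, l). cmod (g k - g l)) ` ({..<n} \<times> {..<n})"
    unfolding D_def by (rule Max_in) (use n0 in auto)
  then obtain i j where ij: "i < n" "j < n" "D = cmod (g i - g j)" by auto
  \<comment> \<open>Diameter 0 would make \<open>x\<close> a multiple of \<open>u\<close> and force
    \<open>l\<close> to be the Perron root.\<close>
  have "D \<noteq> 0"
  proof
    assume "D = 0"
    then have xk: "x $ k = g 0 * of_real (u $ k)" if "k < n" for k
      using D_ge[OF that n0] U(3)[OF that] by (simp add: g_def field_simps)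
    have "l * x $ k = of_real r * x $ k" if k: "k < n" for k
    proof -
      have "l * x $ k = (\<Sum>q<n. C $$ (k, q) * x $ q)"
        using mult_mat_vec_index[OF C xc k] Cx k xc by simp
      also have "\<dots> = (\<Sum>q<n. g 0 * of_real (A $$ (k, q) * u $ q))"
        by (rule sum.cong) (use A k xk in auto)
      also have "\<dots> = g 0 * of_real ((A *\<^sub>v u) $ k)"
        unfolding mult_mat_vec_index[OF A U(1) k] of_real_sum sum_distrib_left ..
      also have "\<dots> = of_real r * x $ k" using u(2) k U(2) xk by simp
      finally show ?thesis .
    qed
    moreover obtain k where "k < n" "x $ k \<noteq> 0" using x0 xc by (auto simp: vec_eq_iff)
    ultimately show False using l(2) by auto
  qed
  then have D: "0 < D" using ij(3) by simp
  \<comment> \<open>Multiplying \<open>x\<close> by \<open>c\<close> makes \<open>l * (g i - g j)\<close> nonnegative real; \<open>c = 0\<close> if \<open>l = 0\<close>.\<close>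
  define c where "c = cnj (sgn (l * (g i - g j)))"
  have c: "cmod c \<le> 1" by (simp add: c_def norm_sgn)
  define z where "z = vec n (\<lambda>k. Re (c * x $ k))"
  have z: "z \<in> carrier_vec n" by (simp add: z_def)
  have zg: "z $ k / u $ k = Re (c * g k)" if "k < n" for k
    using that by (simp add: z_def g_def Re_divide_of_real del: times_complex.sel)
  \<comment> \<open>Since \<open>A\<close> is real, multiplication by it commutes with taking real
    parts.\<close>
  have Azg: "(A *\<^sub>v z) $ k / u $ k = Re (c * l * g k)" if k: "k < n" for k
  proof -
    have "(A *\<^sub>v z) $ k = (\<Sum>q<n. Re (c * (C $$ (k, q) * x $ q)))"
      unfolding mult_mat_vec_index[OF A z k]
      by (rule sum.cong) (use A k in \<open>auto simp: z_def algebra_simps\<close>)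
    also have "\<dots> = Re (c * (C *\<^sub>v x) $ k)"
      unfolding mult_mat_vec_index[OF C xc k] Re_sum[symmetric] sum_distrib_left ..
    also have "\<dots> = Re (c * l * x $ k)" unfolding Cx using k xc by (simp add: mult.assoc)
    finally show ?thesis by (simp add: g_def Re_divide_of_real del: times_complex.sel)
  qed
  have "(A *\<^sub>v z) $ i / u $ i - (A *\<^sub>v z) $ j / u $ j \<le> r * (birkhoff_coeff A * D)"
  proof (rule oscillation_contract[OF u r z _ ij(1,2)])
    fix k m assume km: "k < n" "m < n"
    have "z $ k / u $ k - z $ m / u $ m = Re (c * (g k - g m))"
      by (simp add: zg km right_diff_distrib del: times_complex.sel)
    also have "\<dots> \<le> cmod c * cmod (g k - g m)" using complex_Re_le_cmod norm_mult by metis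
    also have "\<dots> \<le> 1 * D" by (rule mult_mono) (use c D_ge km in auto)
    finally show "z $ k / u $ k - z $ m / u $ m \<le> D" by simp
  qed
  moreover have "(A *\<^sub>v z) $ i / u $ i - (A *\<^sub>v z) $ j / u $ j = cmod l * D"
  proof -
    have "(A *\<^sub>v z) $ i / u $ i - (A *\<^sub>v z) $ j / u $ j = Re (c * (l * (g i - g j)))"
      by (simp add: Azg ij right_diff_distrib mult.assoc del: times_complex.sel index_mult_mat_vec)
    also have "\<dots> = cmod l * D" unfolding c_def cnj_sgn_mult by (simp add: norm_mult ij(3))
    finally show ?thesis .
  qed
  ultimately have "cmod l * D \<le> (r * birkhoff_coeff A) * D" by (simp add: mult.assoc)
  then show ?thesis using D by (simp only: mult_le_cancel_right_pos)
qed

lemma spectral_ratio_le: "spectral_ratio A \<le> birkhoff_coeff A"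
proof -
  let ?S = "{cmod l | l. eigenvalue C l \<and> l \<noteq> complex_of_real (perron_root A)}"
  have r: "0 < r" using perron_vector by blast
  \<comment> \<open>\<open>Max\<close> is meaningful only on a finite nonempty set; finiteness comes
    from the spectrum and nonemptiness from \<open>other_eigenvalue\<close>.\<close>
  have "?S \<subseteq> cmod ` spectrum C" by (auto simp: spectrum_def)
  then have "finite ?S" using card_finite_spectrum(1)[OF C] finite_surj by blast
  moreover have "?S \<noteq> {}" using other_eigenvalue perron_root_eq by auto
  ultimately have "Max ?S \<le> r * birkhoff_coeff A"
    by (rule Max.boundedI) (use cmod_other_eigenvalue_le perron_root_eq in auto)
  then show ?thesis unfolding spectral_ratio_def perron_root_eq
    using r by (simp add: divide_le_eq mult.commute)
qed

end

theorem theorem1p1: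
  fixes n :: nat and A :: "real mat"
  assumes "2 \<le> n"
    and "A \<in> carrier_mat n n"
    and "\<And>i j. i < n \<Longrightarrow> j < n \<Longrightarrow> 0 < A $$ (i, j)"
  shows "spectral_ratio A \<le> birkhoff_coeff A"
proof -
  interpret positive_matrix n A by unfold_locales (use assms in auto)
  show ?thesis by (rule spectral_ratio_le)
qed

end
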